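(* Let $\mathcal{H}$ be a complex Hilbert space, let $A\neq 0$ be a positive bounded linear operator on $\mathcal{H}$, and let $T\in\mathcal{B}_A(\mathcal{H})$. Then $$\frac12\sqrt{\big\|TT^{\sharp_A}+T^{\sharp_A}T\big\|_A+2c_A(T^2)}\le\omega_A(T)\le\frac12\sqrt{\big\|TT^{\sharp_A}+T^{\sharp_A}T\big\|_A+2\omega_A(T^2)} .$$
   Context: $\mathcal{B}(\mathcal{H})$ denotes the bounded linear operators on the complex Hilbert space $(\mathcal{H},\langle\cdot\mid\cdot\rangle)$. $A\in\mathcal{B}(\mathcal{H})$ is positive, meaning $\langle Ax\mid x\rangle\ge 0$ for all $x$. Put $\langle x\mid y\rangle_A=\langle Ax\mid y\rangle$ and $\|x\|_A=\sqrt{\langle x\mid x\rangle_A}$. $\mathcal{B}_A(\mathcal{H})$ is the set of $T\in\mathcal{B}(\mathcal{H})$ for which there is $S\in\mathcal{B}(\mathcal{H})$ with $AS=T^*A$ (equivalently $\mathcal{R}(T^*A)\subseteq\mathcal{R}(A)$, where $\mathcal{R}$ denotes range). For $T\in\mathcal{B}_A(\mathcal{H})$, $T^{\sharp_A}$ is the unique $S\in\mathcal{B}(\mathcal{H})$ with $AS=T^*A$ and $\mathcal{R}(S)\subseteq\overline{\mathcal{R}(A)}$. The $A$-operator seminorm is $\|T\|_A=\sup\{\|Tx\|_A: x\in\mathcal{H},\ \|x\|_A=1\}$, the $A$-numerical radius is $\omega_A(T)=\sup\{|\langle Tx\mid x\rangle_A|: x\in\mathcal{H},\ \|x\|_A=1\}$,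 and the $A$-Crawford number is $c_A(T)=\inf\{|\langle Tx\mid x\rangle_A|: x\in\mathcal{H},\ \|x\|_A=1\}$. *)

theory Defs
  imports "HOL-Analysis.Analysis"
begin

text \<open>
  Complex Hilbert spaces are introduced as a type class. The inner product is linear in its
  first and conjugate-linear in its second argument. The triangle inequality contained in
  \<^class>\<open>real_normed_vector\<close> is redundant (it follows from the other axioms); it is assumed so
  that the library's real normed space theory applies directly.
\<close>

class complex_vector = real_vector +
  fixes scaleC :: "complex \<Rightarrow> 'a \<Rightarrow> 'a" (infixr "*\<^sub>C" 75)
  assumes scaleC_add_right: "c *\<^sub>C (x + y) = c *\<^sub>C x + c *\<^sub>C y"
    and scaleC_add_left: "(c + d) *\<^sub>C x = c *\<^sub>C x + d *\<^sub>C x"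
    and scaleC_scaleC: "c *\<^sub>C d *\<^sub>C x = (c * d) *\<^sub>C x"
    and scaleC_of_real: "complex_of_real r *\<^sub>C x = r *\<^sub>R x"

class complex_inner = complex_vector + real_normed_vector +
  fixes cinner :: "'a \<Rightarrow> 'a \<Rightarrow> complex"
  assumes cinner_commute: "cinner x y = cnj (cinner y x)"
    and cinner_add_left: "cinner (x + y) z = cinner x z + cinner y z"
    and cinner_scaleC_left: "cinner (c *\<^sub>C x) y = c * cinner x y"
    and cinner_nonneg: "0 \<le> Re (cinner x x)"
    and cinner_eq_zero_iff: "cinner x x = 0 \<longleftrightarrow> x = 0"
    and norm_eq_sqrt_cinner: "norm x = sqrt (Re (cinner x x))"

class complex_hilbert = complex_inner + complete_space

definition bounded_clinear :: "('h::complex_inner \<Rightarrow> 'h) \<Rightarrow> bool" where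
  "bounded_clinear T \<longleftrightarrow> bounded_linear T \<and> (\<forall>c x. T (c *\<^sub>C x) = c *\<^sub>C T x)"

definition positive_op :: "('h::complex_inner \<Rightarrow> 'h) \<Rightarrow> bool" where
  "positive_op A \<longleftrightarrow>
     bounded_clinear A \<and> (\<forall>x. cinner (A x) x \<in> \<real> \<and> 0 \<le> Re (cinner (A x) x))"

definition cadjoint :: "('h::complex_hilbert \<Rightarrow> 'h) \<Rightarrow> 'h \<Rightarrow> 'h" where
  "cadjoint T = (THE S. bounded_clinear S \<and> (\<forall>x y. cinner (T x) y = cinner x (S y)))"

definition A_inner :: "('h::complex_inner \<Rightarrow> 'h) \<Rightarrow> 'h \<Rightarrow> 'h \<Rightarrow> complex" where
  "A_inner A x y = cinner (A x) y"

text \<open>For positive \<open>A\<close> the number \<open>A_inner A x x\<close> is real, so taking its real part loses nothing.\<close>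

definition A_norm :: "('h::complex_inner \<Rightarrow> 'h) \<Rightarrow> 'h \<Rightarrow> real" where
  "A_norm A x = sqrt (Re (A_inner A x x))"

definition B_A :: "('h::complex_hilbert \<Rightarrow> 'h) \<Rightarrow> ('h \<Rightarrow> 'h) set" where
  "B_A A = {T. bounded_clinear T \<and> (\<exists>S. bounded_clinear S \<and> A \<circ> S = cadjoint T \<circ> A)}"

definition A_sharp :: "('h::complex_hilbert \<Rightarrow> 'h) \<Rightarrow> ('h \<Rightarrow> 'h) \<Rightarrow> 'h \<Rightarrow> 'h" where
  "A_sharp A T =
     (THE S. bounded_clinear S \<and> A \<circ> S = cadjoint T \<circ> A \<and> range S \<subseteq> closure (range A))"

text \<open>
  The supremum and infimum below are taken in the reals. For positive \<open>A \<noteq> 0\<close> the index set is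
  nonempty, and for \<open>T \<in> B_A A\<close> the sets are bounded, so they have their usual meaning there.
\<close>

definition A_opnorm :: "('h::complex_inner \<Rightarrow> 'h) \<Rightarrow> ('h \<Rightarrow> 'h) \<Rightarrow> real" where
  "A_opnorm A T = Sup {A_norm A (T x) | x. A_norm A x = 1}"

definition A_numradius :: "('h::complex_inner \<Rightarrow> 'h) \<Rightarrow> ('h \<Rightarrow> 'h) \<Rightarrow> real" where
  "A_numradius A T = Sup {cmod (A_inner A (T x) x) | x. A_norm A x = 1}"

definition A_crawford :: "('h::complex_inner \<Rightarrow> 'h) \<Rightarrow> ('h \<Rightarrow> 'h) \<Rightarrow> real" where
  "A_crawford A T = Inf {cmod (A_inner A (T x) x) | x. A_norm A x = 1}"

end

theory Submission
  imports Defs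
begin

text \<open>
  Write \<open>S\<close> for the \<open>A\<close>-adjoint of \<open>T\<close> and \<open>P = T S + S T\<close>. For a unimodular \<open>u\<close> consider the
  rotated (and doubled) real part \<open>H = u T + u\<^sup>* S\<close>, with \<open>u\<^sup>*\<close> the conjugate of \<open>u\<close>. It is
  symmetric for the \<open>A\<close>-inner product, its quadratic form is \<open>2 Re (u \<langle>T x, x\<rangle>)\<close>, and squaring it
  gives the identity behind both inequalities (\<open>rotated_real_part\<close>):
  \<open>\<parallel>H x\<parallel>\<^sup>2 = \<langle>P x, x\<rangle> + 2 Re (u\<^sup>2 \<langle>T\<^sup>2 x, x\<rangle>)\<close>.

  For the upper bound fix a unit vector \<open>x\<close> and choose \<open>u\<close> with \<open>u \<langle>T x, x\<rangle> = |\<langle>T x, x\<rangle>|\<close>. Then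
  \<open>2 |\<langle>T x, x\<rangle>| = \<langle>H x, x\<rangle> \<le> \<parallel>H x\<parallel>\<close>, and the identity bounds the right-hand side
  (\<open>diagonal_upper_bound\<close>). For the lower bound choose \<open>u\<close> with
  \<open>u\<^sup>2 \<langle>T\<^sup>2 x, x\<rangle> = |\<langle>T\<^sup>2 x, x\<rangle>|\<close> instead. A symmetric operator has seminorm at most its numerical
  radius (\<open>symmetric_seminorm_bound\<close>), so \<open>\<parallel>H x\<parallel> \<le> 2 \<omega>(T)\<close> and hence
  \<open>\<langle>P x, x\<rangle> \<le> 4 \<omega>(T)\<^sup>2 - 2 c(T\<^sup>2)\<close>. Applying the same fact to the symmetric operator \<open>P\<close> turns this
  into a bound on its seminorm (\<open>product_sum_upper_bound\<close>).

  These computations use only a positive semidefinite sesquilinear form and a pair of mutually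
  adjoint linear maps. Completeness enters in the existence of that pair: the orthogonal
  projection theorem gives the Riesz representation, hence Hilbert space adjoints, and the
  projection onto the closure of the range of \<open>A\<close> turns an arbitrary solution of
  \<open>A S = T\<^sup>* A\<close> into the distinguished one (\<open>A_sharp_is_adjoint\<close>). Finally, the real suprema
  have their usual meaning only if they are taken over bounded sets. An operator bounded in the
  Hilbert space norm need not be bounded in the seminorm, but a symmetric one is, because the
  seminorms of its iterates form a log-convex sequence of at most geometric growth
  (\<open>symmetric_operator_A_bounded\<close>). This applies to \<open>P\<close>, and to \<open>S T\<close>, which controls \<open>T\<close>.
\<close>

section \<open>Growth of log-convex sequences\<close>

text \<open>
  The ratios of consecutive terms of a log-convex sequence increase, so an initial ratio above \<open>K\<close>
  would force growth faster than \<open>K ^ n\<close>.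
\<close>

lemma log_convex_growth:
  fixes a :: "nat \<Rightarrow> real"
  assumes nonneg: "\<And>n. 0 \<le> a n"
    and convex: "\<And>n. (a (Suc n))\<^sup>2 \<le> a n * a (Suc (Suc n))"
    and K: "0 < K" and growth: "\<And>n. a n \<le> C * K ^ n"
  shows "a 1 \<le> K * a 0"
proof (cases "a 0 = 0")
  case True
  then show ?thesis using convex[of 0] by simp
next
  case False
  then have a0: "a 0 > 0" using nonneg[of 0] by simp
  show ?thesis
  proof (rule ccontr)
    assume "\<not> a 1 \<le> K * a 0"
    then have gt: "K * a 0 < a 1" by simp
    define r where "r = a 1 / a 0"
    have r: "r > K" using gt a0 by (simp add: r_def pos_less_divide_eq)
    have step: "0 < a n \<and> r * a n \<le> a (Suc n)" for n
    proof (induction n)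
      case 0
      then show ?case using a0 by (simp add: r_def)
    next
      case (Suc n)
      then have pos: "0 < a (Suc n)"
        using r K by (smt (verit) mult_pos_pos)
      have "(r * a n) * a (Suc n) \<le> a (Suc n) * a (Suc n)"
        using Suc pos by (intro mult_right_mono) simp_all
      also have "\<dots> \<le> a n * a (Suc (Suc n))"
        using convex[of n] by (simp add: power2_eq_square)
      finally have "a n * (r * a (Suc n)) \<le> a n * a (Suc (Suc n))"
        by (simp add: mult_ac)
      then show ?case using Suc pos by (simp add: mult_le_cancel_left_pos)
    qed
    have power: "r ^ n * a 0 \<le> a n" for n
    proof (induction n)
      case (Suc n)
      have "r ^ Suc n * a 0 = r * (r ^ n * a 0)" by simp
      also have "\<dots> \<le> r * a n" using Suc r K by (intro mult_left_mono) simp_all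
      also have "\<dots> \<le> a (Suc n)" using step by simp
      finally show ?case .
    qed simp
    obtain n where n: "C / a 0 < (r / K) ^ n"
      using real_arch_pow[of "r / K" "C / a 0"] r K by auto
    have "C * K ^ n < r ^ n * a 0"
      using n a0 K by (simp add: power_divide field_simps)
    then show False using power[of n] growth[of n] by linarith
  qed
qed

section \<open>Positive sesquilinear forms\<close>

definition clinear_map :: "('h::complex_vector \<Rightarrow> 'h) \<Rightarrow> bool" where
  "clinear_map L \<longleftrightarrow> (\<forall>x y. L (x + y) = L x + L y) \<and> (\<forall>c x. L (c *\<^sub>C x) = c *\<^sub>C L x)"

lemma clinear_map_add: "clinear_map L \<Longrightarrow> L (x + y) = L x + L y"
  and clinear_map_scaleC: "clinear_map L \<Longrightarrow> L (c *\<^sub>C x) = c *\<^sub>C L x"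
  by (auto simp: clinear_map_def)

lemma scaleC_minus_one: "(-1) *\<^sub>C x = - (x::'h::complex_vector)"
  using scaleC_of_real[of "-1" x] by simp

lemma clinear_map_diff: "clinear_map L \<Longrightarrow> L (x - y) = L x - L y"
  unfolding diff_conv_add_uminus
  by (simp only: clinear_map_add scaleC_minus_one[symmetric] clinear_map_scaleC)

lemma clinear_map_zero: "clinear_map L \<Longrightarrow> L 0 = 0"
  using clinear_map_diff[of L 0 0] by simp

lemma exists_unimodular_rotation: "\<exists>u. cmod u = 1 \<and> u * z = complex_of_real (cmod z)"
proof (cases "z = 0")
  case True
  then show ?thesis by (intro exI[of _ 1]) simp
next
  case False
  then show ?thesis
    by (intro exI[of _ "cnj z / complex_of_real (cmod z)"])
       (simp add: norm_divide complex_norm_square[symmetric] power2_eq_square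
          mult.commute[of "cnj z"])
qed

text \<open>
  The form may be degenerate. This is what happens for the \<open>A\<close>-inner product of an operator \<open>A\<close>
  with a kernel, while the inner product of the Hilbert space is a definite instance; both are
  interpreted below, so the Cauchy-Schwarz inequality and the norm identities are proved once.
\<close>

locale positive_form =
  fixes B :: "'h::complex_vector \<Rightarrow> 'h \<Rightarrow> complex"
  assumes add_left: "B (x + y) z = B x z + B y z"
    and scaleC_left: "B (c *\<^sub>C x) y = c * B x y"
    and hermitian: "B x y = cnj (B y x)"
    and nonneg: "0 \<le> Re (B x x)"
begin

definition seminorm :: "'h \<Rightarrow> real" where
  "seminorm x = sqrt (Re (B x x))"

lemma add_right: "B x (y + z) = B x y + B x z"
  by (metis add_left complex_cnj_add hermitian)

lemma scaleC_right: "B x (c *\<^sub>C y) = cnj c * B x y"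
  by (metis scaleC_left complex_cnj_mult hermitian)

lemma minus_left: "B (- x) y = - B x y"
  using scaleC_left[of "-1" x y] by (simp add: scaleC_minus_one)

lemma minus_right: "B x (- y) = - B x y"
  using scaleC_right[of x "-1" y] by (simp add: scaleC_minus_one)

lemma diff_left: "B (x - y) z = B x z - B y z"
  using add_left[of x "- y" z] by (simp add: minus_left)

lemma diff_right: "B x (y - z) = B x y - B x z"
  using add_right[of x y "- z"] by (simp add: minus_right)

lemma seminorm_nonneg: "0 \<le> seminorm x"
  by (simp add: seminorm_def nonneg)

lemma seminorm_square: "(seminorm x)\<^sup>2 = Re (B x x)"
  by (simp add: seminorm_def nonneg)

lemma Im_diagonal: "Im (B x x) = 0"
proof -
  have "Im (B x x) = Im (cnj (B x x))"
    using hermitian[of x x] by simp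
  then show ?thesis by simp
qed

lemma diagonal_eq: "B x x = complex_of_real ((seminorm x)\<^sup>2)"
  by (simp add: complex_eq_iff Im_diagonal seminorm_square)

lemma seminorm_scaleC: "seminorm (c *\<^sub>C x) = cmod c * seminorm x"
proof (rule power2_eq_imp_eq)
  have "B (c *\<^sub>C x) (c *\<^sub>C x) = (c * cnj c) * B x x"
    by (simp add: scaleC_left scaleC_right mult_ac)
  also have "\<dots> = complex_of_real ((cmod c)\<^sup>2 * (seminorm x)\<^sup>2)"
    unfolding complex_norm_square[symmetric] diagonal_eq[of x] by simp
  finally show "(seminorm (c *\<^sub>C x))\<^sup>2 = (cmod c * seminorm x)\<^sup>2"
    by (simp add: seminorm_square power_mult_distrib)
qed (simp_all add: seminorm_nonneg)

lemma seminorm_add_square: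
  "(seminorm (x + y))\<^sup>2 = (seminorm x)\<^sup>2 + (seminorm y)\<^sup>2 + 2 * Re (B x y)"
proof -
  have "Re (B y x) = Re (B x y)"
    by (subst hermitian) simp
  then show ?thesis
    by (simp add: seminorm_square add_left add_right)
qed

lemma seminorm_diff_square:
  "(seminorm (x - y))\<^sup>2 = (seminorm x)\<^sup>2 + (seminorm y)\<^sup>2 - 2 * Re (B x y)"
proof -
  have "Re (B y x) = Re (B x y)"
    by (subst hermitian) simp
  then show ?thesis
    by (simp add: seminorm_square diff_left diff_right)
qed

lemma cauchy_schwarz: "cmod (B x y) \<le> seminorm x * seminorm y"
proof -
  obtain u where u: "cmod u = 1" "u * B x y = complex_of_real (cmod (B x y))"
    using exists_unimodular_rotation by blast
  define k where "k = cmod (B x y)"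
  define a where "a = seminorm x"
  define b where "b = seminorm y"
  have ab: "a \<ge> 0" "b \<ge> 0" "k \<ge> 0"
    by (simp_all add: a_def b_def k_def seminorm_nonneg)
  have quad: "0 \<le> s\<^sup>2 * a\<^sup>2 + t\<^sup>2 * b\<^sup>2 - 2 * (s * t * k)" for s t :: real
  proof -
    have "B ((complex_of_real s * u) *\<^sub>C x) (complex_of_real t *\<^sub>C y)
        = complex_of_real s * complex_of_real t * (u * B x y)"
      by (simp add: scaleC_left scaleC_right)
    also have "\<dots> = complex_of_real (s * t * k)"
      by (simp add: u(2) k_def)
    finally show ?thesis
      using seminorm_diff_square[of "(complex_of_real s * u) *\<^sub>C x" "complex_of_real t *\<^sub>C y"]
        zero_le_power2[of "seminorm ((complex_of_real s * u) *\<^sub>C x - complex_of_real t *\<^sub>C y)"]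
      by (simp add: seminorm_scaleC norm_mult u(1) power_mult_distrib a_def b_def)
  qed
  \<comment> \<open>If both seminorms are nonzero, \<open>s = b\<close> and \<open>t = a\<close> balance the square terms. If one of them
    vanishes, its coefficient can be taken large enough for the mixed term to dominate.\<close>
  have "k \<le> a * b"
  proof (cases "a = 0 \<or> b = 0")
    case False
    have "2 * (a * b) * k \<le> 2 * (a * b) * (a * b)"
      using quad[of b a] by (simp add: power2_eq_square algebra_simps)
    then show ?thesis
      using False ab by (simp add: mult_le_cancel_left)
  next
    case True
    show ?thesis
    proof (rule ccontr)
      assume "\<not> k \<le> a * b"
      then have k: "k > 0" using True by auto
      show False
        using True
      proof
        assume a: "a = 0"
        have "0 \<le> k\<^sup>2 * b\<^sup>2 - 2 * ((b\<^sup>2 + 1) * k * k)"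
          using quad[of "b\<^sup>2 + 1" k] a by simp
        also have "\<dots> = - (k\<^sup>2 * (b\<^sup>2 + 2))" by (simp add: algebra_simps power2_eq_square)
        also have "\<dots> < 0" using k by (simp add: add_nonneg_pos)
        finally show False by simp
      next
        assume b: "b = 0"
        have "0 \<le> k\<^sup>2 * a\<^sup>2 - 2 * (k * (a\<^sup>2 + 1) * k)"
          using quad[of k "a\<^sup>2 + 1"] b by simp
        also have "\<dots> = - (k\<^sup>2 * (a\<^sup>2 + 2))" by (simp add: algebra_simps power2_eq_square)
        also have "\<dots> < 0" using k by (simp add: add_nonneg_pos)
        finally show False by simp
      qed
    qed
  qed
  then show ?thesis by (simp add: k_def a_def b_def)
qed

text \<open>
  Vectors of seminorm zero cannot be normalized, but for them both sides vanish by the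
  Cauchy-Schwarz inequality.
\<close>

lemma diagonal_bound_homogeneous:
  assumes L: "clinear_map L"
    and unit: "\<And>x. seminorm x = 1 \<Longrightarrow> cmod (B (L x) x) \<le> m"
  shows "cmod (B (L x) x) \<le> m * (seminorm x)\<^sup>2"
proof (cases "seminorm x = 0")
  case True
  then show ?thesis using cauchy_schwarz[of "L x" x] by simp
next
  case False
  define r where "r = seminorm x"
  have r: "r > 0" using False seminorm_nonneg[of x] by (simp add: r_def)
  define y where "y = complex_of_real (1 / r) *\<^sub>C x"
  have x: "x = complex_of_real r *\<^sub>C y"
    using r by (simp add: y_def scaleC_scaleC scaleC_of_real[of 1, simplified])
  have "seminorm y = 1"
    using r by (simp add: y_def seminorm_scaleC norm_divide r_def[symmetric])
  then have "cmod (B (L y) y) \<le> m" by (rule unit)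
  then have "r\<^sup>2 * cmod (B (L y) y) \<le> r\<^sup>2 * m" by (rule mult_left_mono) simp
  moreover have "cmod (B (L x) x) = r\<^sup>2 * cmod (B (L y) y)"
    using r by (simp add: x clinear_map_scaleC[OF L] scaleC_left scaleC_right norm_mult power2_eq_square)
  ultimately show ?thesis by (simp add: r_def mult.commute)
qed

text \<open>
  Polarization: for a symmetric map the real part of \<open>B (H x) y\<close> is a difference of values of the
  quadratic form at \<open>x + y\<close> and \<open>x - y\<close>, which the parallelogram law bounds by \<open>m\<close> for unit vectors;
  \<open>y\<close> is then taken in the direction of \<open>H x\<close>.
\<close>

lemma symmetric_seminorm_bound:
  assumes H: "clinear_map H"
    and sym: "\<And>x y. B (H x) y = B x (H y)"
    and bound: "\<And>x. seminorm x = 1 \<Longrightarrow> cmod (B (H x) x) \<le> m"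
    and x: "seminorm x = 1"
  shows "seminorm (H x) \<le> m"
proof (cases "seminorm (H x) = 0")
  case True
  have "0 \<le> cmod (B (H x) x)" by simp
  also have "\<dots> \<le> m" using bound x .
  finally show ?thesis using True by simp
next
  case False
  define h where "h = seminorm (H x)"
  have h: "h > 0" using False seminorm_nonneg[of "H x"] by (simp add: h_def)
  define y where "y = complex_of_real (1 / h) *\<^sub>C H x"
  have y: "seminorm y = 1" using h by (simp add: y_def seminorm_scaleC norm_divide h_def[symmetric])
  have Hxy: "B (H x) y = complex_of_real h"
    using h by (simp add: y_def scaleC_right diagonal_eq h_def[symmetric] power2_eq_square)
  have Hyx: "B (H y) x = complex_of_real h"
    by (metis sym hermitian Hxy complex_cnj_complex_of_real)
  have "4 * h = Re (B (H (x + y)) (x + y)) - Re (B (H (x - y)) (x - y))"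
    by (simp add: clinear_map_add[OF H] clinear_map_diff[OF H] add_left add_right
        diff_left diff_right Hxy Hyx)
  also have "\<dots> \<le> cmod (B (H (x + y)) (x + y)) + cmod (B (H (x - y)) (x - y))"
    using complex_Re_le_cmod[of "B (H (x + y)) (x + y)"] abs_Re_le_cmod[of "B (H (x - y)) (x - y)"]
    by linarith
  also have "\<dots> \<le> m * (seminorm (x + y))\<^sup>2 + m * (seminorm (x - y))\<^sup>2"
    by (intro add_mono diagonal_bound_homogeneous[OF H] bound)
  also have "\<dots> = 4 * m"
    by (simp add: seminorm_add_square seminorm_diff_square x y algebra_simps)
  finally show ?thesis by (simp add: h_def)
qed

section \<open>Adjoint pairs and the rotated real part\<close>

definition adjoint_pair :: "('h \<Rightarrow> 'h) \<Rightarrow> ('h \<Rightarrow> 'h) \<Rightarrow> bool" where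
  "adjoint_pair T S \<longleftrightarrow> clinear_map T \<and> clinear_map S \<and> (\<forall>x y. B (T x) y = B x (S y))"

lemma adjoint_pair_swap:
  assumes "adjoint_pair T S"
  shows "B (S x) y = B x (T y)"
  using assms hermitian[of "S x" y] hermitian[of "T y" x] by (simp add: adjoint_pair_def)

lemma product_sum_symmetric:
  assumes "adjoint_pair T S"
  shows "clinear_map (\<lambda>x. T (S x) + S (T x))"
    and "B (T (S x) + S (T x)) y = B x (T (S y) + S (T y))"
  using assms adjoint_pair_swap[OF assms]
  by (auto simp: adjoint_pair_def clinear_map_def scaleC_add_right add_left add_right)

lemma product_sum_diagonal:
  assumes "adjoint_pair T S"
  shows "B (T (S x) + S (T x)) x = complex_of_real ((seminorm (T x))\<^sup>2 + (seminorm (S x))\<^sup>2)"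
  using assms adjoint_pair_swap[OF assms]
  by (simp add: adjoint_pair_def add_left diagonal_eq)

text \<open>
  The square of \<open>H\<close> expands into \<open>u\<^sup>2 T\<^sup>2 + u\<^sup>*\<^sup>2 S\<^sup>2 + T S + S T\<close>; its first two summands are
  adjoint to each other, so together they contribute twice a real part to the quadratic form.
  Rotating \<open>T\<close> by \<open>u\<close> thus rotates the term with \<open>T\<^sup>2\<close> by \<open>u\<^sup>2\<close> and leaves the other one fixed.
\<close>

lemma rotated_real_part:
  assumes TS: "adjoint_pair T S" and u: "cmod u = 1"
    and H_def: "H = (\<lambda>x. u *\<^sub>C T x + cnj u *\<^sub>C S x)"
  shows "clinear_map H"
    and "B (H x) y = B x (H y)"
    and "B (H x) x = complex_of_real (2 * Re (u * B (T x) x))"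
    and "(seminorm (H x))\<^sup>2
         = Re (B (T (S x) + S (T x)) x) + 2 * Re (u\<^sup>2 * B (T (T x)) x)"
proof -
  have T: "clinear_map T" and S: "clinear_map S" and adj: "\<And>x y. B (T x) y = B x (S y)"
    using TS by (auto simp: adjoint_pair_def)
  note adj' = adjoint_pair_swap[OF TS]
  show "clinear_map H"
    using T S by (auto simp: clinear_map_def H_def scaleC_add_right scaleC_scaleC mult.commute)
  show "B (H x) y = B x (H y)"
    by (simp add: H_def add_left add_right scaleC_left scaleC_right adj adj')
  have "B (S x) x = cnj (B (T x) x)"
    by (metis adj' hermitian)
  then show "B (H x) x = complex_of_real (2 * Re (u * B (T x) x))"
    by (simp add: H_def add_left scaleC_left complex_eq_iff)
  show "(seminorm (H x))\<^sup>2
         = Re (B (T (S x) + S (T x)) x) + 2 * Re (u\<^sup>2 * B (T (T x)) x)"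
  proof -
    have "Re (B (u *\<^sub>C T x) (cnj u *\<^sub>C S x)) = Re (u\<^sup>2 * B (T (T x)) x)"
      by (simp add: scaleC_left scaleC_right adj power2_eq_square mult.assoc)
    then show ?thesis
      by (simp add: H_def seminorm_add_square seminorm_scaleC u product_sum_diagonal[OF TS])
  qed
qed

text \<open>
  Here \<open>u\<close> aligns \<open>\<langle>T x, x\<rangle>\<close> with the positive axis, so that the quadratic form of \<open>H\<close> at \<open>x\<close>
  attains \<open>2 |\<langle>T x, x\<rangle>|\<close>.
\<close>

lemma diagonal_upper_bound:
  assumes TS: "adjoint_pair T S" and x: "seminorm x = 1"
  shows "4 * (cmod (B (T x) x))\<^sup>2
         \<le> seminorm (T (S x) + S (T x)) + 2 * cmod (B (T (T x)) x)"
proof -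
  obtain u where u: "cmod u = 1" "u * B (T x) x = complex_of_real (cmod (B (T x) x))"
    using exists_unimodular_rotation by blast
  define H where "H = (\<lambda>x. u *\<^sub>C T x + cnj u *\<^sub>C S x)"
  note H = rotated_real_part[OF TS u(1) H_def]
  have "2 * cmod (B (T x) x) = cmod (B (H x) x)"
    unfolding H(3) u(2) norm_of_real by simp
  also have "\<dots> \<le> seminorm (H x)"
    using cauchy_schwarz[of "H x" x] x by simp
  finally have "(2 * cmod (B (T x) x))\<^sup>2 \<le> (seminorm (H x))\<^sup>2"
    by (intro power_mono) simp_all
  also have "\<dots> \<le> cmod (B (T (S x) + S (T x)) x) + 2 * cmod (u\<^sup>2 * B (T (T x)) x)"
    unfolding H(4) by (intro add_mono mult_left_mono complex_Re_le_cmod) simp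
  also have "\<dots> \<le> seminorm (T (S x) + S (T x)) + 2 * cmod (B (T (T x)) x)"
    using cauchy_schwarz[of "T (S x) + S (T x)" x] x by (simp add: norm_mult norm_power u(1))
  finally show ?thesis by (simp add: power_mult_distrib)
qed

text \<open>
  Here \<open>u\<^sup>2\<close> aligns \<open>\<langle>T\<^sup>2 x, x\<rangle>\<close> with the positive axis, so that \<open>\<parallel>H x\<parallel>\<^sup>2\<close> is as large as the identity
  permits. The seminorm bound for symmetric maps is used twice: for \<open>H\<close>, whose quadratic form is
  at most \<open>2 m\<close> whatever \<open>u\<close> is, and for \<open>T S + S T\<close> at the end.
\<close>

lemma product_sum_upper_bound:
  assumes TS: "adjoint_pair T S"
    and m: "\<And>x. seminorm x = 1 \<Longrightarrow> cmod (B (T x) x) \<le> m"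
    and c: "\<And>x. seminorm x = 1 \<Longrightarrow> c \<le> cmod (B (T (T x)) x)"
    and x: "seminorm x = 1"
  shows "seminorm (T (S x) + S (T x)) \<le> 4 * m\<^sup>2 - 2 * c"
proof -
  have diag: "cmod (B (T (S x) + S (T x)) x) \<le> 4 * m\<^sup>2 - 2 * c" if x: "seminorm x = 1" for x
  proof -
    obtain w where w: "cmod w = 1" "w * B (T (T x)) x = complex_of_real (cmod (B (T (T x)) x))"
      using exists_unimodular_rotation by blast
    define u where "u = csqrt w"
    have u: "cmod u = 1" "u\<^sup>2 = w"
      using w(1) by (simp_all add: u_def norm_csqrt)
    define H where "H = (\<lambda>x. u *\<^sub>C T x + cnj u *\<^sub>C S x)"
    note H = rotated_real_part[OF TS u(1) H_def]
    have "seminorm (H x) \<le> 2 * m"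
    proof (rule symmetric_seminorm_bound[OF H(1,2) _ x])
      fix y assume y: "seminorm y = 1"
      have "\<bar>Re (u * B (T y) y)\<bar> \<le> cmod (B (T y) y)"
        using abs_Re_le_cmod[of "u * B (T y) y"] by (simp add: norm_mult u(1))
      then show "cmod (B (H y) y) \<le> 2 * m"
        using m[OF y] unfolding H(3) norm_of_real by linarith
    qed
    then have "(seminorm (H x))\<^sup>2 \<le> (2 * m)\<^sup>2"
      by (intro power_mono seminorm_nonneg)
    moreover have "cmod (B (T (S x) + S (T x)) x) = Re (B (T (S x) + S (T x)) x)"
      unfolding product_sum_diagonal[OF TS] norm_of_real by simp
    ultimately show ?thesis
      using c[OF x] H(4)[of x] by (simp add: u(2) w(2) power_mult_distrib)
  qed
  show ?thesis
    using symmetric_seminorm_bound[OF product_sum_symmetric[OF TS] diag x] .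
qed

section \<open>Boundedness with respect to the seminorm\<close>

text \<open>
  By symmetry \<open>\<parallel>Q v\<parallel>\<^sup>2 = \<langle>v, Q\<^sup>2 v\<rangle>\<close>, so the Cauchy-Schwarz inequality makes the seminorms of the
  iterates log-convex. Only the exponential rate \<open>K\<close> of their growth survives in the conclusion; the
  factor \<open>C\<close>, which depends on \<open>x\<close>, disappears.
\<close>

lemma symmetric_bound_from_iterates:
  assumes sym: "\<And>x y. B (Q x) y = B x (Q y)"
    and K: "0 < K" and growth: "\<And>n. seminorm ((Q ^^ n) x) \<le> C * K ^ n"
  shows "seminorm (Q x) \<le> K * seminorm x"
proof -
  have "(seminorm (Q v))\<^sup>2 \<le> seminorm v * seminorm (Q (Q v))" for v
  proof -
    have "(seminorm (Q v))\<^sup>2 = cmod (B v (Q (Q v)))"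
      by (simp add: sym[symmetric] diagonal_eq norm_power)
    then show ?thesis using cauchy_schwarz[of v "Q (Q v)"] by simp
  qed
  then have "seminorm ((Q ^^ 1) x) \<le> K * seminorm ((Q ^^ 0) x)"
    by (intro log_convex_growth[where a = "\<lambda>n. seminorm ((Q ^^ n) x)" and C = C] K growth)
       (simp_all add: seminorm_nonneg)
  then show ?thesis by simp
qed

end

section \<open>Orthogonal projections and adjoints in Hilbert space\<close>

interpretation cinner: positive_form "cinner :: 'h::complex_inner \<Rightarrow> 'h \<Rightarrow> complex"
proof
  show "cinner x y = cnj (cinner y x)" for x y :: 'h
    by (rule cinner_commute)
qed (simp_all add: cinner_add_left cinner_scaleC_left cinner_nonneg)

lemma cinner_seminorm_eq_norm: "cinner.seminorm x = norm (x :: 'h::complex_inner)"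
  by (simp add: cinner.seminorm_def norm_eq_sqrt_cinner)

lemma cinner_cauchy_schwarz: "cmod (cinner x y) \<le> norm x * norm (y :: 'h::complex_inner)"
  using cinner.cauchy_schwarz[of x y] by (simp add: cinner_seminorm_eq_norm)

lemma cinner_self: "cinner x x = complex_of_real ((norm (x :: 'h::complex_inner))\<^sup>2)"
  using cinner.diagonal_eq[of x] by (simp add: cinner_seminorm_eq_norm)

lemma norm_scaleC: "norm (c *\<^sub>C x) = cmod c * norm (x :: 'h::complex_inner)"
  using cinner.seminorm_scaleC[of c x] by (simp add: cinner_seminorm_eq_norm)

lemma cinner_extensional:
  fixes x y :: "'h::complex_inner"
  assumes "\<And>z. cinner z x = cinner z y"
  shows "x = y"
proof -
  have "cinner (x - y) (x - y) = 0"
    using assms[of "x - y"] by (simp add: cinner.diff_right)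
  then show ?thesis by (simp add: cinner_eq_zero_iff)
qed

lemma continuous_cinner_left: "continuous_on UNIV (\<lambda>x. cinner x (y :: 'h::complex_inner))"
proof -
  have "bounded_linear (\<lambda>x. cinner x y)"
  proof (rule bounded_linear_intro[where K = "norm y"])
    show "cinner (r *\<^sub>R x) y = r *\<^sub>R cinner x y" for r x
      by (simp add: scaleC_of_real[symmetric] cinner_scaleC_left scaleR_conv_of_real)
  qed (simp_all add: cinner_add_left cinner_cauchy_schwarz)
  then show ?thesis
    by (intro linear_continuous_on)
qed

lemma bounded_clinear_clinear_map: "bounded_clinear L \<Longrightarrow> clinear_map L"
  by (simp add: bounded_clinear_def clinear_map_def linear_simps)

lemma bounded_clinearI:
  fixes L :: "'h::complex_inner \<Rightarrow> 'h"
  assumes L: "clinear_map L" and bound: "\<And>x. norm (L x) \<le> K * norm x"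
  shows "bounded_clinear L"
  unfolding bounded_clinear_def
proof (intro conjI allI)
  show "bounded_linear L"
    using bound
    by (intro bounded_linear_intro[where K = K])
       (simp_all add: clinear_map_add[OF L] scaleC_of_real[symmetric] clinear_map_scaleC[OF L] mult.commute)
qed (rule clinear_map_scaleC[OF L])

lemma bounded_clinear_norm_bound:
  assumes "bounded_clinear L"
  shows "\<exists>K>0. \<forall>x. norm (L x) \<le> K * norm x"
proof -
  from assms have "bounded_linear L" by (simp add: bounded_clinear_def)
  then obtain K where "0 < K" "\<And>x. norm (L x) \<le> norm x * K"
    using bounded_linear.pos_bounded by blast
  then show ?thesis by (auto simp: mult.commute)
qed

definition csubspace_set :: "'h::complex_vector set \<Rightarrow> bool" where
  "csubspace_set M \<longleftrightarrow> 0 \<in> M \<and> (\<forall>x\<in>M. \<forall>y\<in>M. x + y \<in> M) \<and> (\<forall>c. \<forall>x\<in>M. c *\<^sub>C x \<in> M)"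

lemma csubspace_diff: "csubspace_set M \<Longrightarrow> x \<in> M \<Longrightarrow> y \<in> M \<Longrightarrow> x - y \<in> M"
  by (simp only: csubspace_set_def diff_conv_add_uminus scaleC_minus_one[symmetric])

lemma csubspace_closure:
  fixes M :: "'h::complex_inner set"
  assumes M: "csubspace_set M"
  shows "csubspace_set (closure M)"
  unfolding csubspace_set_def
proof (intro conjI ballI allI)
  show "0 \<in> closure M"
    using M closure_subset by (auto simp: csubspace_set_def)
next
  fix x y assume "x \<in> closure M" "y \<in> closure M"
  then obtain f g where fg: "\<And>n. f n \<in> M" "f \<longlonglongrightarrow> x" "\<And>n. g n \<in> M" "g \<longlonglongrightarrow> y"
    using closure_sequential[of x M] closure_sequential[of y M] by auto
  have "(\<lambda>n. f n + g n) \<longlonglongrightarrow> x + y"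
    by (intro tendsto_add fg)
  moreover have "f n + g n \<in> M" for n
    using M fg(1,3) by (simp add: csubspace_set_def)
  ultimately show "x + y \<in> closure M"
    unfolding closure_sequential by (intro exI[of _ "\<lambda>n. f n + g n"]) auto
next
  fix c x assume "x \<in> closure M"
  then obtain f where f: "\<And>n. f n \<in> M" "f \<longlonglongrightarrow> x"
    using closure_sequential[of x M] by auto
  have "bounded_clinear (\<lambda>x::'h. c *\<^sub>C x)"
    by (rule bounded_clinearI[where K = "cmod c"])
       (simp_all add: clinear_map_def scaleC_add_right scaleC_scaleC mult.commute norm_scaleC)
  then have "bounded_linear (\<lambda>x::'h. c *\<^sub>C x)"
    by (simp add: bounded_clinear_def)
  from bounded_linear.tendsto[OF this f(2)] have "(\<lambda>n. c *\<^sub>C f n) \<longlonglongrightarrow> c *\<^sub>C x" .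
  moreover have "c *\<^sub>C f n \<in> M" for n
    using M f(1) by (simp add: csubspace_set_def)
  ultimately show "c *\<^sub>C x \<in> closure M"
    unfolding closure_sequential by (intro exI[of _ "\<lambda>n. c *\<^sub>C f n"]) auto
qed

lemma parallelogram:
  fixes u v :: "'h::complex_inner"
  shows "(norm (u - v))\<^sup>2 = 2 * (norm u)\<^sup>2 + 2 * (norm v)\<^sup>2 - (norm (u + v))\<^sup>2"
  using cinner.seminorm_add_square[of u v] cinner.seminorm_diff_square[of u v]
  by (simp add: cinner_seminorm_eq_norm)

text \<open>
  A minimizing sequence is Cauchy: the midpoint of two of its terms is again in \<open>M\<close>, hence not
  closer to \<open>x\<close> than the infimum, and the parallelogram law then leaves no room between them.
\<close>

lemma nearest_point_exists:
  fixes M :: "'h::complex_hilbert set"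
  assumes M: "csubspace_set M" and closed: "closed M"
  shows "\<exists>p\<in>M. \<forall>y\<in>M. norm (x - p) \<le> norm (x - y)"
proof -
  define d where "d = infdist x M"
  have ne: "M \<noteq> {}" using M by (auto simp: csubspace_set_def)
  have d: "d \<ge> 0" by (simp add: d_def infdist_nonneg)
  have d_le: "d \<le> norm (x - y)" if "y \<in> M" for y
    using infdist_le[OF that, of x] by (simp add: d_def dist_norm)
  have "\<exists>y\<in>M. norm (x - y) < d + 1 / real (Suc n)" for n
  proof -
    have "infdist x M < d + 1 / real (Suc n)" by (simp add: d_def)
    then show ?thesis
      using cInf_lessD[of "dist x ` M" "d + 1 / real (Suc n)"] ne
      by (simp add: infdist_notempty dist_norm)
  qed
  then obtain y where y: "\<And>n. y n \<in> M" "\<And>n. norm (x - y n) < d + 1 / real (Suc n)"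
    by metis
  define e where "e n = (d + 1 / real (Suc n))\<^sup>2 - d\<^sup>2" for n
  have sq: "(norm (x - y n))\<^sup>2 \<le> d\<^sup>2 + e n" for n
    unfolding e_def using y(2)[of n] by (simp add: power_mono)
  have close: "(norm (y m - y n))\<^sup>2 \<le> 2 * e m + 2 * e n" for m n
  proof -
    have mid: "complex_of_real (1/2) *\<^sub>C (y m + y n) \<in> M"
      using M y(1) by (simp add: csubspace_set_def)
    have "(x - y m) + (x - y n) = 2 *\<^sub>R (x - complex_of_real (1/2) *\<^sub>C (y m + y n))"
      unfolding scaleC_of_real by (simp add: algebra_simps scaleR_2)
    then have "norm ((x - y m) + (x - y n)) = 2 * norm (x - complex_of_real (1/2) *\<^sub>C (y m + y n))"
      by simp
    then have "(2 * d)\<^sup>2 \<le> (norm ((x - y m) + (x - y n)))\<^sup>2"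
      using d_le[OF mid] d by (intro power_mono) simp_all
    then show ?thesis
      using parallelogram[of "x - y m" "x - y n"] sq[of m] sq[of n]
      by (simp add: norm_minus_commute power_mult_distrib)
  qed
  have e_lim: "e \<longlonglongrightarrow> 0"
  proof -
    have "(\<lambda>n. (d + 1 / real (Suc n))\<^sup>2 - d\<^sup>2) \<longlonglongrightarrow> (d + 0)\<^sup>2 - d\<^sup>2"
      by (intro tendsto_intros LIMSEQ_Suc[OF lim_1_over_n])
    then show ?thesis by (simp add: e_def[abs_def])
  qed
  have "Cauchy y"
  proof (rule CauchyI)
    fix r :: real assume r: "0 < r"
    then have "\<forall>\<^sub>F n in sequentially. e n < r\<^sup>2 / 4"
      by (intro order_tendstoD(2)[OF e_lim]) simp
    then obtain N where N: "\<And>n. n \<ge> N \<Longrightarrow> e n < r\<^sup>2 / 4"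
      by (auto simp: eventually_sequentially)
    have "norm (y m - y n) < r" if "m \<ge> N" "n \<ge> N" for m n
    proof (rule power_less_imp_less_base[where n = 2])
      show "(norm (y m - y n))\<^sup>2 < r\<^sup>2"
        using close[of m n] N[OF that(1)] N[OF that(2)] by linarith
    qed (use r in simp)
    then show "\<exists>N. \<forall>m\<ge>N. \<forall>n\<ge>N. norm (y m - y n) < r" by blast
  qed
  then obtain p where p: "y \<longlonglongrightarrow> p"
    using Cauchy_convergent_iff convergent_def by blast
  have "p \<in> M"
    using closed_sequentially[OF closed _ p] y(1) by blast
  moreover have "norm (x - p) \<le> d"
  proof (rule LIMSEQ_le)
    show "(\<lambda>n. norm (x - y n)) \<longlonglongrightarrow> norm (x - p)"
      by (intro tendsto_intros p)
    show "(\<lambda>n. d + 1 / real (Suc n)) \<longlonglongrightarrow> d"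
      using tendsto_add[OF tendsto_const[of d] LIMSEQ_Suc[OF lim_1_over_n]] by simp
    show "\<exists>N. \<forall>n\<ge>N. norm (x - y n) \<le> d + 1 / real (Suc n)"
      using y(2) less_imp_le by blast
  qed
  ultimately show ?thesis using d_le order_trans by blast
qed

text \<open>
  If \<open>x - p\<close> had a component along some \<open>y\<close> in \<open>M\<close>, moving \<open>p\<close> by that component would decrease the
  distance to \<open>x\<close>.
\<close>

lemma orthogonal_decomposition:
  fixes M :: "'h::complex_hilbert set"
  assumes M: "csubspace_set M" and closed: "closed M"
  shows "\<exists>p\<in>M. \<forall>y\<in>M. cinner (x - p) y = 0"
proof -
  obtain p where p: "p \<in> M" and min: "\<And>y. y \<in> M \<Longrightarrow> norm (x - p) \<le> norm (x - y)"
    using nearest_point_exists[OF M closed] by blast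
  have "cinner (x - p) y = 0" if y: "y \<in> M" for y
  proof (cases "y = 0")
    case True
    then show ?thesis using cinner.scaleC_right[of "x - p" 0 y] scaleC_of_real[of 0 y] by simp
  next
    case False
    define z where "z = cinner (x - p) y"
    define c where "c = z / complex_of_real ((norm y)\<^sup>2)"
    have n: "norm y > 0" using False by simp
    have "p + c *\<^sub>C y \<in> M" using M p y by (simp add: csubspace_set_def)
    from min[OF this] have "(norm (x - p))\<^sup>2 \<le> (norm ((x - p) - c *\<^sub>C y))\<^sup>2"
      by (intro power_mono) (simp_all add: diff_diff_eq)
    also have "\<dots> = (norm (x - p))\<^sup>2 + (cmod c * norm y)\<^sup>2 - 2 * Re (cnj c * z)"
      using cinner.seminorm_diff_square[of "x - p" "c *\<^sub>C y"]
      by (simp add: cinner_seminorm_eq_norm norm_scaleC cinner.scaleC_right z_def)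
    also have "cnj c * z = complex_of_real ((cmod z)\<^sup>2 / (norm y)\<^sup>2)"
      unfolding c_def of_real_divide complex_norm_square[of z] by (simp add: mult.commute)
    also have "cmod c * norm y = cmod z / norm y"
      using n by (simp add: c_def norm_divide norm_mult power2_eq_square)
    finally have "(cmod z)\<^sup>2 / (norm y)\<^sup>2 \<le> 0"
      by (simp add: power_divide)
    then have "z = 0" using n by (simp add: divide_le_0_iff)
    then show ?thesis by (simp add: z_def)
  qed
  then show ?thesis using p by blast
qed

text \<open>
  Orthogonality determines the point of \<open>M\<close>, and this uniqueness makes the choice of points linear.
\<close>

lemma orthogonal_projection_exists:
  fixes M :: "'h::complex_hilbert set"
  assumes M: "csubspace_set M" and closed: "closed M"
  obtains P where "bounded_clinear P" "\<And>x. P x \<in> M" "\<And>x y. y \<in> M \<Longrightarrow> cinner (x - P x) y = 0"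
proof -
  obtain P where P: "\<And>x. P x \<in> M" "\<And>x y. y \<in> M \<Longrightarrow> cinner (x - P x) y = 0"
    using orthogonal_decomposition[OF M closed] by metis
  have unique: "P x = p" if p: "p \<in> M" "\<And>y. y \<in> M \<Longrightarrow> cinner (x - p) y = 0" for x p
  proof -
    have "P x - p \<in> M" using csubspace_diff[OF M] P(1) p(1) by blast
    then have "cinner (x - p) (P x - p) - cinner (x - P x) (P x - p) = 0"
      using P(2) p(2) by simp
    then have "cinner (P x - p) (P x - p) = 0"
      unfolding cinner.diff_left[symmetric] by simp
    then show ?thesis by (simp add: cinner_eq_zero_iff)
  qed
  have "clinear_map P"
    unfolding clinear_map_def
  proof (intro conjI allI)
    fix x y
    show "P (x + y) = P x + P y"
    proof (rule unique)
      show "P x + P y \<in> M" using M P(1) by (simp add: csubspace_set_def)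
      fix z assume "z \<in> M"
      then show "cinner (x + y - (P x + P y)) z = 0"
        using P(2)[of z x] P(2)[of z y] by (simp add: add_diff_add cinner_add_left)
    qed
  next
    fix c x
    show "P (c *\<^sub>C x) = c *\<^sub>C P x"
    proof (rule unique)
      show "c *\<^sub>C P x \<in> M" using M P(1) by (simp add: csubspace_set_def)
      fix z assume "z \<in> M"
      then show "cinner (c *\<^sub>C x - c *\<^sub>C P x) z = 0"
        using P(2)[of z x] by (simp add: cinner.diff_left cinner_scaleC_left)
    qed
  qed
  moreover have "norm (P x) \<le> 1 * norm x" for x
  proof -
    have "cinner x (P x) = cinner (P x) (P x)"
      using P(2)[OF P(1), of x x] by (simp add: cinner.diff_left)
    then have "(norm (P x))\<^sup>2 = cmod (cinner x (P x))"
      by (simp add: cinner_self norm_power)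
    also have "\<dots> \<le> norm x * norm (P x)" by (rule cinner_cauchy_schwarz)
    finally show ?thesis
      by (cases "norm (P x) = 0") (auto simp: power2_eq_square)
  qed
  ultimately have "bounded_clinear P" by (rule bounded_clinearI)
  then show thesis using that P by blast
qed

text \<open>
  A vector orthogonal to the kernel of \<open>f\<close> represents \<open>f\<close> up to a scalar, since the kernel has
  codimension at most one.
\<close>

lemma riesz_representation:
  fixes f :: "'h::complex_hilbert \<Rightarrow> complex"
  assumes add: "\<And>x y. f (x + y) = f x + f y"
    and scale: "\<And>c x. f (c *\<^sub>C x) = c * f x"
    and bound: "\<And>x. cmod (f x) \<le> K * norm x"
  shows "\<exists>v. \<forall>x. f x = cinner x v"
proof (cases "\<forall>x. f x = 0")
  case True
  have "cinner x 0 = 0" for x :: 'h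
    using cinner.diff_right[of x 0 0] by simp
  then show ?thesis using True by metis
next
  case False
  then obtain z where z: "f z \<noteq> 0" by blast
  have "bounded_linear f"
    by (rule bounded_linear_intro[where K = K])
       (simp_all add: add scaleC_of_real[symmetric] scale scaleR_conv_of_real bound mult.commute[of _ K])
  then have cont: "continuous_on UNIV f" and f0: "f 0 = 0"
    by (simp_all add: linear_continuous_on linear_simps)
  define M where "M = {x. f x = 0}"
  have M: "csubspace_set M" by (simp add: csubspace_set_def M_def f0 add scale)
  have "closed M" unfolding M_def by (intro closed_Collect_eq cont continuous_on_const)
  from orthogonal_decomposition[OF M this, of z]
  obtain p where p: "p \<in> M" and orth: "\<And>y. y \<in> M \<Longrightarrow> cinner (z - p) y = 0" by blast
  define w where "w = z - p"
  have fw: "f w = f z"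
    using add[of w p] p by (simp add: w_def M_def)
  then have "w \<noteq> 0" using z f0 by auto
  then have ww: "cinner w w \<noteq> 0" by (simp add: cinner_eq_zero_iff)
  have "f x = cinner x (cnj (f w / cinner w w) *\<^sub>C w)" for x
  proof -
    define c where "c = f x / f w"
    have "f (x - c *\<^sub>C w) = f x - c * f w"
      using add[of "x - c *\<^sub>C w" "c *\<^sub>C w"] scale[of c w] by simp
    then have "x - c *\<^sub>C w \<in> M" using z fw by (simp add: M_def c_def)
    then have "cinner (x - c *\<^sub>C w) w = 0"
      using orth cinner_commute[of "x - c *\<^sub>C w" w] by (simp add: w_def)
    then have "cinner x w = c * cinner w w"
      by (simp add: cinner.diff_left cinner_scaleC_left)
    then show ?thesis
      using ww z fw by (simp add: cinner.scaleC_right c_def)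
  qed
  then show ?thesis by blast
qed

text \<open>
  This discharges the description operator in the definition of \<^const>\<open>cadjoint\<close>: existence is the
  Riesz representation applied to \<open>x \<mapsto> \<langle>T x, y\<rangle>\<close>, uniqueness the nondegeneracy of the inner product.
\<close>

lemma cinner_cadjoint:
  fixes T :: "'h::complex_hilbert \<Rightarrow> 'h"
  assumes T: "bounded_clinear T"
  shows "cinner (T x) y = cinner x (cadjoint T y)"
proof -
  note Tl = bounded_clinear_clinear_map[OF T]
  obtain K where K: "0 < K" "\<And>x. norm (T x) \<le> K * norm x"
    using bounded_clinear_norm_bound[OF T] by auto
  have "\<exists>v. \<forall>x. cinner (T x) y = cinner x v" for y
  proof (rule riesz_representation[where K = "K * norm y"])
    fix x
    have "cmod (cinner (T x) y) \<le> norm (T x) * norm y" by (rule cinner_cauchy_schwarz)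
    also have "\<dots> \<le> K * norm x * norm y" using K(2) by (intro mult_right_mono) simp_all
    finally show "cmod (cinner (T x) y) \<le> K * norm y * norm x" by (simp add: mult_ac)
  qed (simp_all add: clinear_map_add[OF Tl] clinear_map_scaleC[OF Tl] cinner_add_left cinner_scaleC_left)
  then obtain S where S: "\<And>x y. cinner (T x) y = cinner x (S y)" by metis
  have "clinear_map S"
    unfolding clinear_map_def
  proof (intro conjI allI)
    show "S (x + y) = S x + S y" for x y
      by (rule cinner_extensional) (simp add: S[symmetric] cinner.add_right)
    show "S (c *\<^sub>C x) = c *\<^sub>C S x" for c x
      by (rule cinner_extensional) (simp add: S[symmetric] cinner.scaleC_right)
  qed
  moreover have "norm (S y) \<le> K * norm y" for y
  proof -
    have "(norm (S y))\<^sup>2 = cmod (cinner (T (S y)) y)"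
      by (simp add: S cinner_self norm_power)
    also have "\<dots> \<le> norm (T (S y)) * norm y" by (rule cinner_cauchy_schwarz)
    also have "\<dots> \<le> K * norm (S y) * norm y" using K(2) by (intro mult_right_mono) simp_all
    finally show ?thesis
      using K(1) by (cases "norm (S y) = 0") (auto simp: power2_eq_square)
  qed
  ultimately have "bounded_clinear S" by (rule bounded_clinearI)
  then have "\<exists>!S. bounded_clinear S \<and> (\<forall>x y. cinner (T x) y = cinner x (S y))"
  proof (intro ex1I[of _ S] conjI allI)
    fix S' assume S': "bounded_clinear S' \<and> (\<forall>x y. cinner (T x) y = cinner x (S' y))"
    show "S' = S"
    proof
      fix y
      have "cinner x (S' y) = cinner x (S y)" for x
        using S' S[of x y] by simp
      then show "S' y = S y" by (rule cinner_extensional)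
    qed
  qed (simp_all add: S)
  from theI'[OF this] show ?thesis unfolding cadjoint_def by blast
qed

section \<open>The form induced by a positive operator\<close>

text \<open>
  Only hermitian symmetry needs an argument. On a complex space it follows from real values on the
  diagonal, by expanding the quadratic form at \<open>x + y\<close> and at \<open>x + \<i> y\<close>.
\<close>

lemma positive_op_form:
  fixes A :: "'h::complex_inner \<Rightarrow> 'h"
  assumes "positive_op A"
  shows "positive_form (A_inner A)"
proof -
  have A: "clinear_map A" and real: "\<And>x. Im (cinner (A x) x) = 0"
    and pos: "\<And>x. 0 \<le> Re (cinner (A x) x)"
    using assms by (auto simp: positive_op_def bounded_clinear_clinear_map complex_is_Real_iff)
  have hermitian: "cinner (A x) y = cnj (cinner (A y) x)" for x y
  proof -
    have "Im (cinner (A x) y) + Im (cinner (A y) x) = 0"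
      using real[of "x + y"] real[of x] real[of y]
      by (simp add: clinear_map_add[OF A] cinner.add_left cinner.add_right)
    moreover have "Re (cinner (A y) x) - Re (cinner (A x) y) = 0"
      using real[of "x + \<i> *\<^sub>C y"] real[of x] real[of y]
      by (simp add: clinear_map_add[OF A] clinear_map_scaleC[OF A] cinner.add_left cinner.add_right
          cinner.scaleC_left cinner.scaleC_right)
    ultimately show ?thesis by (simp add: complex_eq_iff)
  qed
  show ?thesis
  proof
    show "A_inner A x y = cnj (A_inner A y x)" for x y
      unfolding A_inner_def by (rule hermitian)
  qed (simp_all add: A_inner_def clinear_map_add[OF A] clinear_map_scaleC[OF A]
        cinner_add_left cinner_scaleC_left pos)
qed

text \<open>
  Given any bounded solution of \<open>A S = T\<^sup>* A\<close>, composing it with the orthogonal projection \<open>P\<close> onto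
  the closure of the range of \<open>A\<close> does not change \<open>A S\<close>, because \<open>x - P x\<close> is orthogonal to the
  range of the symmetric operator \<open>A\<close> and hence in its kernel. Symmetry also
  makes the kernel of \<open>A\<close> orthogonal to this closure, so that the two meet only in \<open>0\<close>; this gives
  uniqueness.
\<close>

lemma A_sharp_is_adjoint:
  fixes A T :: "'h::complex_hilbert \<Rightarrow> 'h"
  assumes A: "positive_op A" and T: "T \<in> B_A A"
  shows "bounded_clinear (A_sharp A T)"
    and "A_inner A (T x) y = A_inner A x (A_sharp A T y)"
proof -
  interpret A: positive_form "A_inner A" by (rule positive_op_form[OF A])
  have bA: "bounded_clinear A" using A by (simp add: positive_op_def)
  note lA = bounded_clinear_clinear_map[OF bA]
  have symA: "cinner (A x) y = cinner x (A y)" for x y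
    by (metis A.hermitian A_inner_def cinner_commute)
  define M where "M = closure (range A)"
  have "csubspace_set (range A)"
    unfolding csubspace_set_def
    by (auto simp flip: clinear_map_add[OF lA] clinear_map_scaleC[OF lA] intro: range_eqI[of _ _ 0] simp: clinear_map_zero[OF lA])
  then have M: "csubspace_set M" "closed M"
    by (auto simp: M_def csubspace_closure)
  have kernel: "cinner x y = 0" if "A x = 0" "y \<in> M" for x y
  proof -
    have "cinner (A z) x = 0" for z
      by (metis that(1) symA cinner.diff_right diff_self)
    then have "range A \<subseteq> {y. cinner y x = 0}" by auto
    moreover have "closed {y. cinner y x = 0}"
      by (intro closed_Collect_eq continuous_cinner_left continuous_on_const)
    ultimately have "cinner y x = 0"
      using that(2) closure_minimal unfolding M_def by blast
    then show ?thesis using cinner_commute[of x y] by simp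
  qed
  from T obtain S\<^sub>0 where bT: "bounded_clinear T" and S\<^sub>0: "bounded_clinear S\<^sub>0" "A \<circ> S\<^sub>0 = cadjoint T \<circ> A"
    by (auto simp: B_A_def)
  obtain P where P: "bounded_clinear P" "\<And>x. P x \<in> M" "\<And>x y. y \<in> M \<Longrightarrow> cinner (x - P x) y = 0"
    using orthogonal_projection_exists[OF M] by blast
  have AP: "A (P x) = A x" for x
  proof -
    have "cinner z (A (x - P x)) = cinner z 0" for z
    proof -
      have "A z \<in> M" unfolding M_def by (rule subsetD[OF closure_subset rangeI])
      from P(3)[OF this] have "cinner (A (x - P x)) z = 0" by (simp add: symA)
      then have "cinner z (A (x - P x)) = 0" using cinner_commute[of z] by simp
      moreover have "cinner z 0 = 0" using cinner.diff_right[of z 0 0] by simp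
      ultimately show ?thesis by simp
    qed
    then have "A (x - P x) = 0" by (rule cinner_extensional)
    then show ?thesis by (simp add: clinear_map_diff[OF lA])
  qed
  have "\<exists>!S. bounded_clinear S \<and> A \<circ> S = cadjoint T \<circ> A \<and> range S \<subseteq> M"
  proof (rule ex1I[of _ "P \<circ> S\<^sub>0"])
    have "bounded_clinear (P \<circ> S\<^sub>0)"
      using P(1) S\<^sub>0(1) unfolding bounded_clinear_def o_def
      by (auto intro: bounded_linear_compose)
    then show "bounded_clinear (P \<circ> S\<^sub>0) \<and> A \<circ> (P \<circ> S\<^sub>0) = cadjoint T \<circ> A \<and> range (P \<circ> S\<^sub>0) \<subseteq> M"
      using P(2) S\<^sub>0(2) by (auto simp: fun_eq_iff AP)
  next
    fix S assume S: "bounded_clinear S \<and> A \<circ> S = cadjoint T \<circ> A \<and> range S \<subseteq> M"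
    show "S = P \<circ> S\<^sub>0"
    proof
      fix x
      define v where "v = S x - P (S\<^sub>0 x)"
      have "A (S x) = A (S\<^sub>0 x)"
        using S S\<^sub>0(2) by (simp add: fun_eq_iff)
      then have "A v = 0"
        by (simp add: v_def clinear_map_diff[OF lA] AP)
      moreover have "v \<in> M"
        unfolding v_def using S P(2) by (intro csubspace_diff[OF M(1)]) auto
      ultimately have "v = 0" using kernel cinner_eq_zero_iff by blast
      then show "S x = (P \<circ> S\<^sub>0) x" by (simp add: v_def)
    qed
  qed
  from theI'[OF this] have sharp: "bounded_clinear (A_sharp A T)" "A \<circ> A_sharp A T = cadjoint T \<circ> A"
    unfolding A_sharp_def M_def by auto
  show "bounded_clinear (A_sharp A T)" by (rule sharp)
  have "A_inner A (T x) y = cinner (T x) (A y)" by (simp add: A_inner_def symA)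
  also have "\<dots> = cinner x (cadjoint T (A y))" by (rule cinner_cadjoint[OF bT])
  also have "\<dots> = cinner x (A (A_sharp A T y))" using sharp(2) by (simp add: fun_eq_iff)
  finally show "A_inner A (T x) y = A_inner A x (A_sharp A T y)" by (simp add: A_inner_def symA)
qed

text \<open>
  The \<open>A\<close>-seminorm is at most a constant times the norm, so the iterates of \<open>Q\<close> grow in it no faster
  than geometrically, with the operator norm bound \<open>K\<close> as rate.
\<close>

lemma symmetric_operator_A_bounded:
  fixes A Q :: "'h::complex_hilbert \<Rightarrow> 'h"
  assumes A: "positive_op A" and Q: "bounded_clinear Q"
    and sym: "\<And>x y. A_inner A (Q x) y = A_inner A x (Q y)"
  shows "\<exists>K>0. \<forall>x. A_norm A (Q x) \<le> K * A_norm A x"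
proof -
  interpret A: positive_form "A_inner A" by (rule positive_op_form[OF A])
  have norm_eq: "A.seminorm = A_norm A"
    by (simp add: fun_eq_iff A.seminorm_def A_norm_def)
  obtain K where K: "0 < K" "\<And>x. norm (Q x) \<le> K * norm x"
    using bounded_clinear_norm_bound[OF Q] by auto
  have "bounded_clinear A" using A by (simp add: positive_op_def)
  then obtain a where a: "0 < a" "\<And>x. norm (A x) \<le> a * norm x"
    using bounded_clinear_norm_bound[of A] by auto
  have A_norm_le: "A.seminorm x \<le> sqrt a * norm x" for x
  proof -
    have "Re (A_inner A x x) \<le> norm (A x) * norm x"
      unfolding A_inner_def by (rule order_trans[OF complex_Re_le_cmod cinner_cauchy_schwarz])
    also have "\<dots> \<le> a * norm x * norm x" using a(2) by (intro mult_right_mono) simp_all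
    finally have "sqrt (Re (A_inner A x x)) \<le> sqrt (a * (norm x)\<^sup>2)"
      by (simp add: power2_eq_square mult.assoc)
    then show ?thesis by (simp add: A.seminorm_def real_sqrt_mult)
  qed
  have "norm ((Q ^^ n) x) \<le> K ^ n * norm x" for n x
  proof (induction n)
    case (Suc n)
    have "norm ((Q ^^ Suc n) x) \<le> K * norm ((Q ^^ n) x)" using K(2) by simp
    also have "\<dots> \<le> K * (K ^ n * norm x)" using Suc K(1) by (intro mult_left_mono) simp_all
    finally show ?case by (simp add: mult.assoc)
  qed simp
  then have "A.seminorm ((Q ^^ n) x) \<le> (sqrt a * norm x) * K ^ n" for n x
    using a(1) order_trans[OF A_norm_le mult_left_mono, of "(Q ^^ n) x" "K ^ n * norm x"]
    by (simp add: mult_ac)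
  then have "A.seminorm (Q x) \<le> K * A.seminorm x" for x
    by (rule A.symmetric_bound_from_iterates[OF sym K(1)])
  then show ?thesis using K(1) by (auto simp: norm_eq)
qed

theorem corollary2p1:
  fixes A T :: "'h::complex_hilbert \<Rightarrow> 'h"
  assumes "positive_op A"
    and "A \<noteq> (\<lambda>x. 0)"
    and "T \<in> B_A A"
  shows "1 / 2 * sqrt (A_opnorm A (\<lambda>x. T (A_sharp A T x) + A_sharp A T (T x))
                        + 2 * A_crawford A (T \<circ> T)) \<le> A_numradius A T
       \<and> A_numradius A T \<le>
         1 / 2 * sqrt (A_opnorm A (\<lambda>x. T (A_sharp A T x) + A_sharp A T (T x))
                        + 2 * A_numradius A (T \<circ> T))"
proof -
  interpret A: positive_form "A_inner A" by (rule positive_op_form[OF assms(1)])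
  have norm_eq: "A_norm A = A.seminorm"
    by (simp add: fun_eq_iff A.seminorm_def A_norm_def)
  define S where "S = A_sharp A T"
  define P where "P = (\<lambda>x. T (S x) + S (T x))"
  have bT: "bounded_clinear T" using assms(3) by (simp add: B_A_def)
  have bS: "bounded_clinear S" and adj: "\<And>x y. A_inner A (T x) y = A_inner A x (S y)"
    unfolding S_def by (rule A_sharp_is_adjoint[OF assms(1,3)])+
  have TS: "A.adjoint_pair T S"
    by (simp add: A.adjoint_pair_def bT bS bounded_clinear_clinear_map adj)
  have bST: "bounded_clinear (\<lambda>x. S (T x))" and bP: "bounded_clinear P"
    using bT bS unfolding P_def bounded_clinear_def
    by (auto intro: bounded_linear_compose bounded_linear_add simp: scaleC_add_right)

  \<comment> \<open>Without a unit vector the suprema and the infimum would range over the empty set.\<close>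
  have unit_exists: "\<exists>x. A.seminorm x = 1"
  proof -
    obtain v where v: "A v \<noteq> 0" using assms(2) by blast
    have "A.seminorm v \<noteq> 0"
    proof
      assume "A.seminorm v = 0"
      then have "cinner (A v) (A v) = 0"
        using A.cauchy_schwarz[of v "A v"] by (simp add: A_inner_def)
      then show False using v by (simp add: cinner_eq_zero_iff)
    qed
    then have "A.seminorm (complex_of_real (1 / A.seminorm v) *\<^sub>C v) = 1"
      using A.seminorm_nonneg[of v] by (simp add: A.seminorm_scaleC norm_divide)
    then show ?thesis by blast
  qed

  have "A_inner A (S (T x)) y = A_inner A x (S (T y))" for x y
    by (simp add: A.adjoint_pair_swap[OF TS] adj)
  from symmetric_operator_A_bounded[OF assms(1) bST this]
  obtain K where K: "0 < K" "\<And>x. A.seminorm (S (T x)) \<le> K * A.seminorm x"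
    unfolding norm_eq by auto
  \<comment> \<open>\<open>T\<close> itself is not symmetric, but \<open>\<parallel>T x\<parallel>\<^sup>2 = \<langle>x, S T x\<rangle>\<close> transfers the bound for \<open>S T\<close> to it.\<close>
  have T_bound: "A.seminorm (T x) \<le> sqrt K * A.seminorm x" for x
  proof -
    have "(A.seminorm (T x))\<^sup>2 = cmod (A_inner A x (S (T x)))"
      by (simp add: adj[symmetric] A.diagonal_eq norm_power)
    also have "\<dots> \<le> A.seminorm x * A.seminorm (S (T x))" by (rule A.cauchy_schwarz)
    also have "\<dots> \<le> A.seminorm x * (K * A.seminorm x)"
      by (intro mult_left_mono K(2) A.seminorm_nonneg)
    finally have "(A.seminorm (T x))\<^sup>2 \<le> (sqrt K * A.seminorm x)\<^sup>2"
      using K(1) by (simp add: power_mult_distrib power2_eq_square[of "A.seminorm x"] mult_ac)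
    then show ?thesis
      using K(1) A.seminorm_nonneg by (intro power2_le_imp_le[OF _ mult_nonneg_nonneg]) simp_all
  qed
  have "A_inner A (P x) y = A_inner A x (P y)" for x y
    unfolding P_def by (rule A.product_sum_symmetric(2)[OF TS])
  from symmetric_operator_A_bounded[OF assms(1) bP this]
  obtain L where L: "0 < L" "\<And>x. A.seminorm (P x) \<le> L * A.seminorm x"
    unfolding norm_eq by auto

  have numradius_upper: "cmod (A_inner A (T x) x) \<le> A_numradius A T" if "A.seminorm x = 1" for x
    unfolding A_numradius_def norm_eq
  proof (rule cSup_upper)
    have "cmod (A_inner A (T x) x) \<le> sqrt K" if "A.seminorm x = 1" for x
      using A.cauchy_schwarz[of "T x" x] T_bound[of x] that by simp
    then show "bdd_above {cmod (A_inner A (T x) x) |x. A.seminorm x = 1}"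
      by (intro bdd_aboveI[where M = "sqrt K"]) auto
  qed (use that in blast)
  have numradius_square_upper: "cmod (A_inner A ((T \<circ> T) x) x) \<le> A_numradius A (T \<circ> T)"
    if "A.seminorm x = 1" for x
    unfolding A_numradius_def norm_eq
  proof (rule cSup_upper)
    have "cmod (A_inner A (T (T x)) x) \<le> sqrt K * sqrt K" if x: "A.seminorm x = 1" for x
    proof -
      have "cmod (A_inner A (T (T x)) x) \<le> A.seminorm (T (T x))"
        using A.cauchy_schwarz[of "T (T x)" x] x by simp
      also have "\<dots> \<le> sqrt K * A.seminorm (T x)" by (rule T_bound)
      also have "\<dots> \<le> sqrt K * sqrt K"
        using T_bound[of x] x K(1) by (intro mult_left_mono) simp_all
      finally show ?thesis .
    qed
    then show "bdd_above {cmod (A_inner A ((T \<circ> T) x) x) |x. A.seminorm x = 1}"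
      by (intro bdd_aboveI[where M = "sqrt K * sqrt K"]) auto
  qed (use that in blast)
  have opnorm_upper: "A.seminorm (P x) \<le> A_opnorm A P" if "A.seminorm x = 1" for x
    unfolding A_opnorm_def norm_eq
  proof (rule cSup_upper)
    have "A.seminorm (P x) \<le> L" if "A.seminorm x = 1" for x
      using L(2)[of x] that by simp
    then show "bdd_above {A.seminorm (P x) |x. A.seminorm x = 1}"
      by (intro bdd_aboveI[where M = L]) auto
  qed (use that in blast)
  have crawford_lower: "A_crawford A (T \<circ> T) \<le> cmod (A_inner A (T (T x)) x)"
    if "A.seminorm x = 1" for x
    unfolding A_crawford_def norm_eq
    by (rule cInf_lower) (use that in \<open>auto intro!: bdd_belowI[of _ 0]\<close>)

  have numradius_nonneg: "0 \<le> A_numradius A T"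
  proof -
    obtain x where x: "A.seminorm x = 1" using unit_exists ..
    have "0 \<le> cmod (A_inner A (T x) x)" by simp
    also have "\<dots> \<le> A_numradius A T" by (rule numradius_upper[OF x])
    finally show ?thesis .
  qed
  have "A_opnorm A P \<le> 4 * (A_numradius A T)\<^sup>2 - 2 * A_crawford A (T \<circ> T)"
  proof -
    have "A.seminorm (P x) \<le> 4 * (A_numradius A T)\<^sup>2 - 2 * A_crawford A (T \<circ> T)"
      if "A.seminorm x = 1" for x
      unfolding P_def
      by (rule A.product_sum_upper_bound[OF TS numradius_upper crawford_lower that])
    then show ?thesis
      unfolding A_opnorm_def norm_eq by (intro cSup_least) (use unit_exists in auto)
  qed
  then have "sqrt (A_opnorm A P + 2 * A_crawford A (T \<circ> T)) \<le> 2 * A_numradius A T"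
    using numradius_nonneg by (intro real_le_lsqrt) (simp_all add: power_mult_distrib)
  then have lower: "1 / 2 * sqrt (A_opnorm A P + 2 * A_crawford A (T \<circ> T)) \<le> A_numradius A T"
    by simp

  have "cmod (A_inner A (T x) x) \<le> 1 / 2 * sqrt (A_opnorm A P + 2 * A_numradius A (T \<circ> T))"
    if x: "A.seminorm x = 1" for x
  proof -
    have "(2 * cmod (A_inner A (T x) x))\<^sup>2 \<le> A_opnorm A P + 2 * A_numradius A (T \<circ> T)"
      using A.diagonal_upper_bound[OF TS x] opnorm_upper[OF x] numradius_square_upper[OF x]
      by (simp add: P_def power_mult_distrib)
    from real_le_rsqrt[OF this] show ?thesis by simp
  qed
  then have upper: "A_numradius A T \<le> 1 / 2 * sqrt (A_opnorm A P + 2 * A_numradius A (T \<circ> T))"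
    unfolding A_numradius_def[of A T] norm_eq
    by (intro cSup_least) (use unit_exists in auto)

  show ?thesis using lower upper by (simp add: P_def S_def)
qed

end
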